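(* Let $\mathfrak{M}$ be a von Neumann algebra, $\mathcal{H}$ a Hilbert space, $\mathfrak{X}$ a complex vector space, and let $\Phi:\mathfrak{X}\times\mathfrak{X}\to\mathfrak{B}\bigl(\mathfrak{M},(\mathfrak{B}(\mathcal{H}),\|\cdot\|_{n.r.})\bigr)$ be a positive sesquilinear map. Then for all $x,y\in\mathfrak{X}$, $$\|\Phi(x,y)\|\le\|\Phi(x,x)\|^{1/2}\,\|\Phi(y,y)\|^{1/2},$$ where $\|\cdot\|$ denotes the operator norm of $\mathfrak{B}\bigl(\mathfrak{M},(\mathfrak{B}(\mathcal{H}),\|\cdot\|_{n.r.})\bigr)$.
   Context: The numerical radius norm on $\mathfrak{B}(\mathcal{H})$ is $\|T\|_{n.r.}=\sup_{h\in\mathcal{H},\,\|h\|=1}|\langle Th,h\rangle|$. $\mathfrak{B}\bigl(\mathfrak{M},(\mathfrak{B}(\mathcal{H}),\|\cdot\|_{n.r.})\bigr)$ is the space of bounded linear operators from $\mathfrak{M}$ (with its $C^*$-norm) into $\mathfrak{B}(\mathcal{H})$ equipped with $\|\cdot\|_{n.r.}$, endowed with the operator norm $\|\Psi\|=\sup_{\|T\|_{\mathfrak{M}}\le1}\|\Psi(T)\|_{n.r.}$. Its positive cone consists of the operators mapping positive elements of $\mathfrak{M}$ into positive elements of $\mathfrak{B}(\mathcal{H})$. Sesquilinear means linear in the first variable and conjugate-linear in the second; $\Phi$ is positive if $\Phi(x,x)$ belongs to this positive cone for every $x\in\mathfrak{X}$. *)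

theory Defs
  imports "HOL-Analysis.Analysis"
begin

subsection \<open>Complex vector spaces and complex Hilbert spaces\<close>

class complex_vector = real_vector +
  fixes scaleC :: "complex \<Rightarrow> 'a \<Rightarrow> 'a"  (infixr \<open>*\<^sub>C\<close> 75)
  assumes scaleC_add_right: "c *\<^sub>C (x + y) = c *\<^sub>C x + c *\<^sub>C y"
    and scaleC_add_left: "(c + d) *\<^sub>C x = c *\<^sub>C x + d *\<^sub>C x"
    and scaleC_scaleC: "c *\<^sub>C d *\<^sub>C x = (c * d) *\<^sub>C x"
    and scaleC_one: "1 *\<^sub>C x = x"
    and scaleR_scaleC: "r *\<^sub>R x = complex_of_real r *\<^sub>C x"

text \<open>The inner product is linear in the first argument. The last axiom says both that the
  form is positive definite and that the norm is the one it induces.\<close>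

class complex_inner = complex_vector + real_normed_vector +
  fixes cinner :: "'a \<Rightarrow> 'a \<Rightarrow> complex"
  assumes cinner_add_left: "cinner (x + y) z = cinner x z + cinner y z"
    and cinner_scaleC_left: "cinner (c *\<^sub>C x) y = c * cinner x y"
    and cinner_commute: "cinner x y = cnj (cinner y x)"
    and cinner_self: "cinner x x = complex_of_real ((norm x)\<^sup>2)"

class chilbert_space = complex_inner + complete_space

lemma norm_scaleC: "norm (c *\<^sub>C x) = cmod c * norm x"
  for x :: "'a::complex_inner"
proof -
  have "cinner (c *\<^sub>C x) (c *\<^sub>C x) = c * cnj (c * cinner x x)"
    by (metis cinner_commute cinner_scaleC_left)
  also have "\<dots> = complex_of_real ((cmod c * norm x)\<^sup>2)"
    by (simp add: cinner_self power_mult_distrib complex_norm_square del: of_real_power)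
  finally have "(norm (c *\<^sub>C x))\<^sup>2 = (cmod c * norm x)\<^sup>2"
    unfolding cinner_self of_real_eq_iff .
  then show ?thesis
    by (simp add: power2_eq_iff_nonneg)
qed

lemma bounded_linear_scaleC: "bounded_linear (\<lambda>x::'a::complex_inner. c *\<^sub>C x)"
proof (rule bounded_linear_intro[where K = "cmod c"])
  show "c *\<^sub>C (x + y) = c *\<^sub>C x + c *\<^sub>C y" for x y :: 'a
    by (rule scaleC_add_right)
  show "c *\<^sub>C r *\<^sub>R x = r *\<^sub>R c *\<^sub>C x" for r and x :: 'a
    by (simp add: scaleR_scaleC scaleC_scaleC mult.commute)
  show "norm (c *\<^sub>C x) \<le> norm x * cmod c" for x :: 'a
    by (simp add: norm_scaleC)
qed

instantiation blinfun :: (real_normed_vector, complex_inner) complex_vector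
begin

lift_definition scaleC_blinfun :: "complex \<Rightarrow> ('a \<Rightarrow>\<^sub>L 'b) \<Rightarrow> 'a \<Rightarrow>\<^sub>L 'b"
  is "\<lambda>c f x. c *\<^sub>C f x"
  by (rule bounded_linear_compose[OF bounded_linear_scaleC])

instance
  by standard
    (transfer, simp add: fun_eq_iff scaleC_add_right scaleC_add_left scaleC_scaleC scaleC_one
      scaleR_scaleC)+

end

subsection \<open>Bounded operators and von Neumann algebras\<close>

text \<open>The type \<open>'h \<Rightarrow>\<^sub>L 'h\<close> consists of the real-linear bounded maps, so the algebra of
  bounded operators on a complex Hilbert space is a proper subset of it in general.
  The norm it inherits is the usual operator norm.\<close>

definition bounded_ops :: "('h::chilbert_space \<Rightarrow>\<^sub>L 'h) set"
  where "bounded_ops = {T. \<forall>c h. blinfun_apply T (c *\<^sub>C h) = c *\<^sub>C blinfun_apply T h}"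

definition is_adjoint :: "('h::chilbert_space \<Rightarrow>\<^sub>L 'h) \<Rightarrow> ('h \<Rightarrow>\<^sub>L 'h) \<Rightarrow> bool"
  where "is_adjoint S T \<longleftrightarrow>
    (\<forall>h k. cinner (blinfun_apply T h) k = cinner h (blinfun_apply S k))"

definition positive_op :: "('h::chilbert_space \<Rightarrow>\<^sub>L 'h) \<Rightarrow> bool"
  where "positive_op T \<longleftrightarrow>
    T \<in> bounded_ops \<and> (\<forall>h. cinner (blinfun_apply T h) h \<in> \<real>\<^sub>\<ge>\<^sub>0)"

text \<open>The coarsest topology on the bounded operators making every matrix coefficient
  continuous; \<open>euclidean\<close> on the function type is the topology of pointwise convergence.\<close>

definition weak_operator_topology :: "('h::chilbert_space \<Rightarrow>\<^sub>L 'h) topology"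
  where "weak_operator_topology =
    pullback_topology bounded_ops (\<lambda>T (h, k). cinner (blinfun_apply T h) k) euclidean"

definition von_neumann_algebra :: "('k::chilbert_space \<Rightarrow>\<^sub>L 'k) set \<Rightarrow> bool"
  where "von_neumann_algebra M \<longleftrightarrow>
    M \<subseteq> bounded_ops \<and>
    id_blinfun \<in> M \<and>
    (\<forall>S\<in>M. \<forall>T\<in>M. S + T \<in> M) \<and>
    (\<forall>c. \<forall>T\<in>M. c *\<^sub>C T \<in> M) \<and>
    (\<forall>S\<in>M. \<forall>T\<in>M. S o\<^sub>L T \<in> M) \<and>
    (\<forall>T\<in>M. \<exists>S\<in>M. is_adjoint S T) \<and>
    closedin weak_operator_topology M"

subsection \<open>Bounded maps into the operators with the numerical radius norm\<close>

text \<open>Inserting \<open>0\<close> only matters for the zero space, where there is no unit vector and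
  the supremum is to be read as \<open>0\<close>.\<close>

definition numerical_radius :: "('h::chilbert_space \<Rightarrow>\<^sub>L 'h) \<Rightarrow> real"
  where "numerical_radius T =
    Sup (insert 0 {cmod (cinner (blinfun_apply T h) h) | h. norm h = 1})"

text \<open>Maps defined on \<open>M\<close> are represented by functions on the whole operator type, of which
  only the values on \<open>M\<close> are used, here and in all definitions below.\<close>

definition bounded_maps ::
    "('k::chilbert_space \<Rightarrow>\<^sub>L 'k) set \<Rightarrow> (('k \<Rightarrow>\<^sub>L 'k) \<Rightarrow> ('h::chilbert_space \<Rightarrow>\<^sub>L 'h)) set"
  where "bounded_maps M = {\<Psi>.
    (\<forall>T\<in>M. \<Psi> T \<in> bounded_ops) \<and>
    (\<forall>S\<in>M. \<forall>T\<in>M. \<Psi> (S + T) = \<Psi> S + \<Psi> T) \<and>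
    (\<forall>c. \<forall>T\<in>M. \<Psi> (c *\<^sub>C T) = c *\<^sub>C \<Psi> T) \<and>
    (\<exists>C. \<forall>T\<in>M. numerical_radius (\<Psi> T) \<le> C * norm T)}"

definition map_norm ::
    "('k::chilbert_space \<Rightarrow>\<^sub>L 'k) set \<Rightarrow> (('k \<Rightarrow>\<^sub>L 'k) \<Rightarrow> ('h::chilbert_space \<Rightarrow>\<^sub>L 'h)) \<Rightarrow> real"
  where "map_norm M \<Psi> = (SUP T\<in>{T\<in>M. norm T \<le> 1}. numerical_radius (\<Psi> T))"

definition positive_map ::
    "('k::chilbert_space \<Rightarrow>\<^sub>L 'k) set \<Rightarrow> (('k \<Rightarrow>\<^sub>L 'k) \<Rightarrow> ('h::chilbert_space \<Rightarrow>\<^sub>L 'h)) \<Rightarrow> bool"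
  where "positive_map M \<Psi> \<longleftrightarrow> (\<forall>T\<in>M. positive_op T \<longrightarrow> positive_op (\<Psi> T))"

definition sesquilinear_map ::
    "('k::chilbert_space \<Rightarrow>\<^sub>L 'k) set \<Rightarrow>
     ('x::complex_vector \<Rightarrow> 'x \<Rightarrow> ('k \<Rightarrow>\<^sub>L 'k) \<Rightarrow> ('h::chilbert_space \<Rightarrow>\<^sub>L 'h)) \<Rightarrow> bool"
  where "sesquilinear_map M \<Phi> \<longleftrightarrow>
    (\<forall>x y. \<Phi> x y \<in> bounded_maps M) \<and>
    (\<forall>x x' y. \<forall>T\<in>M. \<Phi> (x + x') y T = \<Phi> x y T + \<Phi> x' y T) \<and>
    (\<forall>c x y. \<forall>T\<in>M. \<Phi> (c *\<^sub>C x) y T = c *\<^sub>C \<Phi> x y T) \<and>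
    (\<forall>x y y'. \<forall>T\<in>M. \<Phi> x (y + y') T = \<Phi> x y T + \<Phi> x y' T) \<and>
    (\<forall>c x y. \<forall>T\<in>M. \<Phi> x (c *\<^sub>C y) T = cnj c *\<^sub>C \<Phi> x y T)"

definition positive_sesquilinear_map ::
    "('k::chilbert_space \<Rightarrow>\<^sub>L 'k) set \<Rightarrow>
     ('x::complex_vector \<Rightarrow> 'x \<Rightarrow> ('k \<Rightarrow>\<^sub>L 'k) \<Rightarrow> ('h::chilbert_space \<Rightarrow>\<^sub>L 'h)) \<Rightarrow> bool"
  where "positive_sesquilinear_map M \<Phi> \<longleftrightarrow>
    sesquilinear_map M \<Phi> \<and> (\<forall>x. positive_map M (\<Phi> x x))"

end

theory Submission
  imports Defs
begin

text \<open>
  Fix a unit vector \<open>h\<close> and put \<open>\<phi> u v T = \<langle>\<Phi> u v T h, h\<rangle>\<close>. For a positive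
  \<open>P\<close> in \<open>M\<close> the form \<open>\<phi> \<cdot> \<cdot> P\<close> is positive semidefinite, so the Cauchy-Schwarz inequality
  bounds \<open>\<bar>\<phi> x y P\<bar>\<close> by \<open>(\<phi> x x P)^(1/2) (\<phi> y y P)^(1/2)\<close>. The issue is to pass from positive
  operators to an arbitrary contraction \<open>T\<close> and to arrive at
  \<open>\<bar>\<phi> x y T\<bar> \<le> (\<phi> x x 1)^(1/2) (\<phi> y y 1)^(1/2)\<close>.

  If \<open>T\<close> were a finite combination of mutually orthogonal projections with sum \<open>1\<close> and
  coefficients in the unit disc, the Cauchy-Schwarz inequality for sums would suffice; the spectral
  theorem for unitaries and the Russo-Dye theorem reduce the problem to that case. Here
  projections are replaced by the Fejer operators
  \<open>F z = \<Sum>\<bar>n\<bar><N. (N - \<bar>n\<bar>) z\<^sup>n T\<^sub>n\<close> for \<open>\<bar>z\<bar> = 1\<close>, where \<open>T\<^sub>n\<close> is \<open>T\<^sup>n\<close> for \<open>n \<ge> 0\<close> and the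
  adjoint of \<open>T^(-n)\<close> for \<open>n < 0\<close>. They are available for every contraction and need only sums,
  products and adjoints. Two facts make them work:

  \<^item> \<open>F z\<close> is positive, by a telescoping estimate (\<open>fejer_op_quadratic_form\<close>);
  \<^item> as \<open>z\<close> runs through the roots of unity of order \<open>N + 1\<close>, the mean of \<open>F z\<close> is \<open>N\<close> times the
    identity and the mean of \<open>cnj z F z\<close> is \<open>(N - 1) T\<close> (\<open>sum_fejer_op_roots_of_unity\<close>, stated
    for the values of a linear functional).

  Applying the Cauchy-Schwarz inequality at each \<open>F z\<close> and then to the sum over \<open>z\<close> gives
  \<open>(N - 1) \<bar>\<phi> x y T\<bar> \<le> N (\<phi> x x 1)^(1/2) (\<phi> y y 1)^(1/2)\<close>, and \<open>N\<close> tends to infinity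
  (\<open>functional_Cauchy_Schwarz_contraction\<close>). Since \<open>\<phi> x x 1\<close> is at most the numerical radius of
  \<open>\<Phi> x x 1\<close>, taking suprema over \<open>h\<close> and \<open>T\<close> finishes the proof.
\<close>

section \<open>Positive sesquilinear forms\<close>

text \<open>Expanding the form on the diagonal at \<open>x + y\<close> determines the imaginary part of
  \<open>B x y + B y x\<close>; expanding it at \<open>x + \<i> y\<close> determines the real part of \<open>B x y - B y x\<close>.\<close>

lemma hermitian_if_real_diagonal:
  fixes B :: "'x::complex_vector \<Rightarrow> 'x \<Rightarrow> complex"
  assumes add_left: "\<And>x x' y. B (x + x') y = B x y + B x' y"
    and scale_left: "\<And>c x y. B (c *\<^sub>C x) y = c * B x y"
    and add_right: "\<And>x y y'. B x (y + y') = B x y + B x y'"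
    and scale_right: "\<And>c x y. B x (c *\<^sub>C y) = cnj c * B x y"
    and real: "\<And>x. B x x \<in> \<real>"
  shows "B y x = cnj (B x y)"
proof -
  have im: "Im (B u u) = 0" for u
    using real[of u] by (simp add: complex_is_Real_iff)
  have "Im (B x y) + Im (B y x) = 0"
    using im[of "x + y"] im[of x] im[of y] by (simp add: add_left add_right)
  moreover have "Re (B y x) - Re (B x y) = 0"
    using im[of "x + \<i> *\<^sub>C y"] im[of x] im[of y]
    by (simp add: add_left add_right scale_left scale_right)
  ultimately show ?thesis
    by (simp add: complex_eq_iff)
qed

text \<open>The form is only semidefinite, so \<open>B y y\<close> may vanish. The polynomial in \<open>t\<close> obtained from
  \<open>x - t (B x y) y\<close> then has to be affine and bounded below, which forces \<open>B x y = 0\<close>.\<close>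

lemma Cauchy_Schwarz_positive_form:
  fixes B :: "'x::complex_vector \<Rightarrow> 'x \<Rightarrow> complex"
  assumes add_left: "\<And>x x' y. B (x + x') y = B x y + B x' y"
    and scale_left: "\<And>c x y. B (c *\<^sub>C x) y = c * B x y"
    and add_right: "\<And>x y y'. B x (y + y') = B x y + B x y'"
    and scale_right: "\<And>c x y. B x (c *\<^sub>C y) = cnj c * B x y"
    and nonneg: "\<And>x. B x x \<in> \<real>\<^sub>\<ge>\<^sub>0"
  shows "cmod (B x y) \<le> sqrt (Re (B x x)) * sqrt (Re (B y y))"
proof -
  have real: "B u u \<in> \<real>" for u
    using nonneg[of u] nonneg_Reals_subset_Reals by blast
  have herm: "B y x = cnj (B x y)"
    using add_left scale_left add_right scale_right real by (rule hermitian_if_real_diagonal)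
  define a b d where "a = Re (B x x)" and "b = (cmod (B x y))\<^sup>2" and "d = Re (B y y)"
  have quadratic: "0 \<le> a - 2 * t * b + t\<^sup>2 * b * d" for t
  proof -
    define c where "c = - complex_of_real t * B x y"
    have "0 \<le> Re (B (x + c *\<^sub>C y) (x + c *\<^sub>C y))"
      using nonneg by (simp add: complex_nonneg_Reals_iff)
    also have "\<dots> = Re (B x x) + Re (cnj c * B x y) + Re (c * cnj (B x y))
        + Re (c * cnj c * B y y)"
      by (simp add: add_left scale_left add_right scale_right herm algebra_simps)
    also have "cnj c * B x y = complex_of_real (- t * b)"
      by (simp only: c_def b_def of_real_mult complex_norm_square) simp
    also have "c * cnj (B x y) = complex_of_real (- t * b)"
      by (simp only: c_def b_def of_real_mult complex_norm_square) simp
    also have "c * cnj c = complex_of_real (t\<^sup>2 * b)"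
      by (simp only: c_def b_def of_real_mult complex_norm_square) (simp add: power2_eq_square)
    finally show ?thesis
      by (simp add: a_def d_def mult_ac)
  qed
  have "0 \<le> a" "0 \<le> d" "0 \<le> b"
    using nonneg by (auto simp: a_def d_def b_def complex_nonneg_Reals_iff)
  have "b \<le> a * d"
  proof (cases "d = 0")
    case True
    have "b = 0"
    proof (rule ccontr)
      assume "b \<noteq> 0"
      then show False
        using quadratic[of "(a + 1) / (2 * b)"] True \<open>0 \<le> a\<close> by (simp add: field_simps)
    qed
    then show ?thesis
      using True by simp
  next
    case False
    then show ?thesis
      using quadratic[of "1 / d"] \<open>0 \<le> d\<close> by (simp add: field_simps power2_eq_square)
  qed
  then have "sqrt b \<le> sqrt (a * d)"
    by simp
  then show ?thesis
    by (simp add: a_def b_def d_def real_sqrt_mult)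
qed

section \<open>The numerical radius\<close>

lemma cinner_add_right: "cinner x (y + z) = cinner x y + cinner x z"
  by (metis cinner_add_left cinner_commute complex_cnj_add)

lemma cinner_scaleC_right: "cinner x (c *\<^sub>C y) = cnj c * cinner x y"
  by (metis cinner_commute cinner_scaleC_left complex_cnj_mult)

lemma cinner_zero_left [simp]: "cinner 0 x = 0"
  using cinner_add_left[of 0 0 x] by simp

lemma cinner_sum_left: "cinner (sum f A) x = (\<Sum>i\<in>A. cinner (f i) x)"
  by (induction A rule: infinite_finite_induct) (simp_all add: cinner_add_left)

lemma norm_diff_square:
  fixes x y :: "'a::complex_inner"
  shows "(norm (x - y))\<^sup>2 = (norm x)\<^sup>2 - 2 * Re (cinner x y) + (norm y)\<^sup>2"
proof -
  have self: "Re (cinner u u) = (norm u)\<^sup>2" for u :: 'a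
    by (simp add: cinner_self del: of_real_power)
  have "(norm x)\<^sup>2 = Re (cinner ((x - y) + y) ((x - y) + y))"
    by (simp add: self)
  also have "\<dots> = (norm (x - y))\<^sup>2 + Re (cinner (x - y) y) + Re (cinner y (x - y)) + (norm y)\<^sup>2"
    by (simp only: cinner_add_left cinner_add_right plus_complex.sel self)
  also have "Re (cinner y (x - y)) = Re (cinner (x - y) y)"
    by (subst cinner_commute) simp
  also have "cinner (x - y) y = cinner x y - cinner y y"
    using cinner_add_left[of "x - y" y y] by simp
  finally show ?thesis
    by (simp add: self)
qed

lemma cmod_cinner_le: "cmod (cinner x y) \<le> norm x * norm y"
  using Cauchy_Schwarz_positive_form[of cinner x y]
  by (simp add: cinner_add_left cinner_add_right cinner_scaleC_left cinner_scaleC_right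
      cinner_self del: of_real_power)

lemma bdd_above_numerical_range:
  "bdd_above (insert 0 {cmod (cinner (blinfun_apply T h) h) | h. norm h = 1})"
proof -
  have "cmod (cinner (blinfun_apply T k) k) \<le> norm T" if "norm k = 1" for k
    using cmod_cinner_le[of "blinfun_apply T k" k] norm_blinfun[of T k] that by simp
  then show ?thesis
    by (auto intro!: bdd_aboveI[of _ "norm T"])
qed

lemma cinner_le_numerical_radius:
  assumes "norm h = 1"
  shows "cmod (cinner (blinfun_apply T h) h) \<le> numerical_radius T"
  unfolding numerical_radius_def using assms by (intro cSup_upper bdd_above_numerical_range) auto

lemma numerical_radius_nonneg: "0 \<le> numerical_radius T"
  unfolding numerical_radius_def by (intro cSup_upper bdd_above_numerical_range) auto

lemma numerical_radius_leI:
  assumes "\<And>h. norm h = 1 \<Longrightarrow> cmod (cinner (blinfun_apply T h) h) \<le> c" and "0 \<le> c"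
  shows "numerical_radius T \<le> c"
  unfolding numerical_radius_def using assms by (intro cSup_least) auto

lemma numerical_radius_le_map_norm:
  assumes "\<Psi> \<in> bounded_maps M" "T \<in> M" "norm T \<le> 1"
  shows "numerical_radius (\<Psi> T) \<le> map_norm M \<Psi>"
  unfolding map_norm_def
proof (rule cSUP_upper)
  obtain C where C: "\<And>T. T \<in> M \<Longrightarrow> numerical_radius (\<Psi> T) \<le> C * norm T"
    using assms(1) unfolding bounded_maps_def by blast
  have "numerical_radius (\<Psi> T) \<le> \<bar>C\<bar>" if "T \<in> M" "norm T \<le> 1" for T
  proof -
    have "C * norm T \<le> \<bar>C\<bar> * 1"
      using that(2) by (intro mult_mono) auto
    with C[OF that(1)] show ?thesis
      by simp
  qed
  then show "bdd_above ((\<lambda>T. numerical_radius (\<Psi> T)) ` {T \<in> M. norm T \<le> 1})"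
    by (auto intro!: bdd_aboveI)
qed (use assms in simp)

section \<open>Fejer operators of a contraction\<close>

primrec blinfun_power :: "('a::real_normed_vector \<Rightarrow>\<^sub>L 'a) \<Rightarrow> nat \<Rightarrow> 'a \<Rightarrow>\<^sub>L 'a" where
  "blinfun_power T 0 = id_blinfun"
| "blinfun_power T (Suc n) = T o\<^sub>L blinfun_power T n"

lemma blinfun_power_one [simp]: "blinfun_power T (Suc 0) = T"
  by (simp add: blinfun_eqI)

lemma blinfun_power_commute: "T o\<^sub>L blinfun_power T n = blinfun_power T n o\<^sub>L T"
  by (induction n) (auto intro!: blinfun_eqI dest: arg_cong[where f = blinfun_apply] simp: fun_eq_iff)

lemma is_adjoint_power: "is_adjoint S T \<Longrightarrow> is_adjoint (blinfun_power S n) (blinfun_power T n)"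
proof (induction n)
  case (Suc n)
  then show ?case
    unfolding is_adjoint_def blinfun_power.simps(2)[of T]
    by (simp add: blinfun_power_commute[of S])
qed (simp add: is_adjoint_def)

text \<open>For \<open>S\<close> the adjoint of \<open>T\<close> this is \<open>N\<close> times the Fejer mean of the symbol
  \<open>\<Sum>n. z\<^sup>n T\<^sub>n\<close>, that is the sum of \<open>z^(i-j) T_(i-j)\<close> over all \<open>i, j < N\<close>. The entries are grouped by
  \<open>m = max i j\<close>, because this grouping is the one that telescopes in the proof of positivity.\<close>

definition fejer_op ::
    "('h::chilbert_space \<Rightarrow>\<^sub>L 'h) \<Rightarrow> ('h \<Rightarrow>\<^sub>L 'h) \<Rightarrow> nat \<Rightarrow> complex \<Rightarrow> 'h \<Rightarrow>\<^sub>L 'h"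
  where "fejer_op T S N z = (\<Sum>m<N. id_blinfun +
    (\<Sum>k\<in>{1..m}. z ^ k *\<^sub>C blinfun_power T k + cnj z ^ k *\<^sub>C blinfun_power S k))"

text \<open>Let \<open>u m = \<Sum>k<m. z\<^sup>k T\<^sup>k h\<close>, so that \<open>u (m + 1) = h + z T (u m)\<close>. The \<open>m\<close>-th block
  contributes \<open>2 Re \<langle>u (m + 1), h\<rangle> - \<parallel>h\<parallel>\<^sup>2 = \<parallel>u (m + 1)\<parallel>\<^sup>2 - \<parallel>u (m + 1) - h\<parallel>\<^sup>2\<close>. Here the
  subtracted term is \<open>\<parallel>T (u m)\<parallel>\<^sup>2 \<le> \<parallel>u m\<parallel>\<^sup>2\<close>, so the sum over \<open>m < N\<close> is at least
  \<open>\<parallel>u N\<parallel>\<^sup>2\<close>.\<close>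

lemma fejer_op_quadratic_form:
  fixes T S :: "'h::chilbert_space \<Rightarrow>\<^sub>L 'h"
  assumes T: "T \<in> bounded_ops" and adj: "is_adjoint S T"
    and contr: "norm T \<le> 1" and z: "cmod z = 1"
  shows "cinner (blinfun_apply (fejer_op T S N z) h) h \<in> \<real>\<^sub>\<ge>\<^sub>0"
proof -
  define u where "u m = (\<Sum>k<m. z ^ k *\<^sub>C blinfun_apply (blinfun_power T k) h)" for m
  have scale_sum: "c *\<^sub>C sum f A = (\<Sum>k\<in>A. c *\<^sub>C f k)"
    for c and f :: "nat \<Rightarrow> 'h" and A :: "nat set"
    by (rule linear_sum) (rule bounded_linear.linear, rule bounded_linear_scaleC)
  have step: "u (Suc m) = h + z *\<^sub>C blinfun_apply T (u m)" for m
    unfolding u_def using T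
    by (subst sum.lessThan_Suc_shift)
      (simp add: scaleC_one blinfun.sum_right scale_sum scaleC_scaleC bounded_ops_def)
  have S_term: "cinner (blinfun_apply (blinfun_power S k) h) h
      = cnj (cinner (blinfun_apply (blinfun_power T k) h) h)" for k
    using is_adjoint_power[OF adj, of k] cinner_commute unfolding is_adjoint_def by metis
  have block: "cinner h h + (\<Sum>k\<in>{1..m}. z ^ k * cinner (blinfun_apply (blinfun_power T k) h) h
      + cnj z ^ k * cinner (blinfun_apply (blinfun_power S k) h) h)
      = complex_of_real (2 * Re (cinner (u (Suc m)) h) - (norm h)\<^sup>2)" for m
  proof -
    define s where "s = (\<Sum>k\<in>{1..m}. z ^ k * cinner (blinfun_apply (blinfun_power T k) h) h)"
    have "cinner (u (Suc m)) h = cinner h h + s"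
      unfolding u_def s_def cinner_sum_left cinner_scaleC_left
      by (subst lessThan_Suc_atMost, subst atMost_atLeast0, subst sum.atLeast_Suc_atMost) simp_all
    moreover have "(\<Sum>k\<in>{1..m}. z ^ k * cinner (blinfun_apply (blinfun_power T k) h) h
      + cnj z ^ k * cinner (blinfun_apply (blinfun_power S k) h) h) = s + cnj s"
      by (simp add: S_term s_def sum.distrib)
    ultimately show ?thesis
      by (simp add: cinner_self complex_add_cnj del: of_real_power)
  qed
  have grow: "(norm (u (Suc m)))\<^sup>2 - (norm (u m))\<^sup>2 \<le> 2 * Re (cinner (u (Suc m)) h) - (norm h)\<^sup>2"
    for m
  proof -
    have "norm (u (Suc m) - h) = norm (blinfun_apply T (u m))"
      by (simp add: step norm_scaleC z)
    also have "\<dots> \<le> norm T * norm (u m)"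
      by (rule norm_blinfun)
    also have "\<dots> \<le> 1 * norm (u m)"
      using contr by (rule mult_right_mono) simp
    finally have "(norm (u (Suc m) - h))\<^sup>2 \<le> (norm (u m))\<^sup>2"
      by (intro power_mono) simp_all
    then show ?thesis
      by (simp add: norm_diff_square)
  qed
  have "0 \<le> (norm (u N))\<^sup>2 - (norm (u 0))\<^sup>2"
    by (simp add: u_def)
  also have "\<dots> = (\<Sum>m<N. (norm (u (Suc m)))\<^sup>2 - (norm (u m))\<^sup>2)"
    by (rule sum_lessThan_telescope[symmetric])
  also have "\<dots> \<le> (\<Sum>m<N. 2 * Re (cinner (u (Suc m)) h) - (norm h)\<^sup>2)"
    by (rule sum_mono) (rule grow)
  finally have nonneg: "0 \<le> (\<Sum>m<N. 2 * Re (cinner (u (Suc m)) h) - (norm h)\<^sup>2)" .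
  have "cinner (blinfun_apply (fejer_op T S N z) h) h
      = complex_of_real (\<Sum>m<N. 2 * Re (cinner (u (Suc m)) h) - (norm h)\<^sup>2)"
    unfolding fejer_op_def of_real_sum block[symmetric]
    by (simp add: blinfun.sum_left blinfun.add_left scaleC_blinfun.rep_eq cinner_sum_left
        cinner_add_left cinner_scaleC_left)
  then show ?thesis
    using nonneg by (simp only: nonneg_Reals_of_real_iff)
qed

section \<open>Averaging over roots of unity\<close>

lemma sum_powers_root_of_unity:
  fixes w :: complex
  assumes "w ^ L = 1" "w \<noteq> 1"
  shows "(\<Sum>j<L. w ^ j) = 0"
  using assms by (simp add: geometric_sum)

lemma cis_power_ne_one:
  assumes "0 < k" "k < L"
  shows "cis (2 * pi / real L) ^ k \<noteq> 1"
proof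
  assume "cis (2 * pi / real L) ^ k = 1"
  then have "cis (2 * pi * real k / real L) = cis 0"
    by (simp add: Complex.DeMoivre mult_ac)
  then have "Re (cis (2 * pi * real k / real L)) = 1"
    by simp
  then obtain n :: int where "2 * pi * real k / real L = of_int n * 2 * pi"
    by (auto simp: cos_one_2pi_int)
  then have "real k = of_int n * real L"
    using assms by (simp add: field_simps)
  then have "int k = n * int L"
    by (metis of_int_eq_iff of_int_mult of_int_of_nat_eq)
  then have "int L dvd int k"
    by simp
  then show False
    using assms by (auto dest: nat_dvd_not_less)
qed

lemma sum_cis_powers:
  assumes "0 < k" "k < L"
  shows "(\<Sum>j<L. (cis (2 * pi / real L) ^ j) ^ k) = 0"
proof -
  have "cis (2 * pi / real L) ^ L = 1"
    using assms by (simp add: Complex.DeMoivre)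
  then have "(cis (2 * pi / real L) ^ k) ^ L = 1"
    by (metis mult.commute power_mult power_one)
  then have "(\<Sum>j<L. (cis (2 * pi / real L) ^ k) ^ j) = 0"
    using cis_power_ne_one[OF assms] by (rule sum_powers_root_of_unity)
  then show ?thesis
    by (simp add: power_mult[symmetric] mult.commute)
qed

definition complex_linear_on :: "'a::complex_vector set \<Rightarrow> ('a \<Rightarrow> complex) \<Rightarrow> bool"
  where "complex_linear_on M f \<longleftrightarrow>
    (\<forall>S\<in>M. \<forall>T\<in>M. f (S + T) = f S + f T) \<and> (\<forall>c. \<forall>T\<in>M. f (c *\<^sub>C T) = c * f T)"

text \<open>Fejer operators are finite expressions in \<open>T\<close> and its adjoint, so the argument is purely
  algebraic and takes place in a unital algebra of operators closed under adjoints.\<close>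

locale star_algebra =
  fixes M :: "('h::chilbert_space \<Rightarrow>\<^sub>L 'h) set"
  assumes bounded: "M \<subseteq> bounded_ops"
    and id_mem: "id_blinfun \<in> M"
    and add_mem: "S \<in> M \<Longrightarrow> T \<in> M \<Longrightarrow> S + T \<in> M"
    and scaleC_mem: "T \<in> M \<Longrightarrow> c *\<^sub>C T \<in> M"
    and comp_mem: "S \<in> M \<Longrightarrow> T \<in> M \<Longrightarrow> S o\<^sub>L T \<in> M"
    and adjoint_ex: "T \<in> M \<Longrightarrow> \<exists>S\<in>M. is_adjoint S T"
begin

lemma zero_mem: "0 \<in> M"
proof -
  have "(0::complex) *\<^sub>C id_blinfun = (0::'h \<Rightarrow>\<^sub>L 'h)"
    using scaleR_scaleC[of 0 "id_blinfun::'h \<Rightarrow>\<^sub>L 'h"] by simp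
  then show ?thesis
    using scaleC_mem[OF id_mem, of 0] by simp
qed

lemma sum_mem: "(\<And>i. i \<in> A \<Longrightarrow> F i \<in> M) \<Longrightarrow> sum F A \<in> M"
  by (induction A rule: infinite_finite_induct) (auto simp: zero_mem add_mem)

lemma power_mem: "T \<in> M \<Longrightarrow> blinfun_power T n \<in> M"
  by (induction n) (auto simp: id_mem comp_mem)

lemma fejer_op_mem: "T \<in> M \<Longrightarrow> S \<in> M \<Longrightarrow> fejer_op T S N z \<in> M"
  unfolding fejer_op_def by (intro sum_mem add_mem id_mem scaleC_mem power_mem)

lemma positive_fejer_op:
  assumes "T \<in> M" "S \<in> M" "is_adjoint S T" "norm T \<le> 1" "cmod z = 1"
  shows "positive_op (fejer_op T S N z)"
  unfolding positive_op_def
  using fejer_op_mem[OF assms(1,2)] bounded fejer_op_quadratic_form[OF _ assms(3-5)] assms(1)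
  by blast

lemma linear_sum_mem:
  assumes "complex_linear_on M f" "\<And>i. i \<in> A \<Longrightarrow> F i \<in> M"
  shows "f (sum F A) = (\<Sum>i\<in>A. f (F i))"
proof -
  have zero: "f 0 = 0"
    using assms(1) zero_mem unfolding complex_linear_on_def by (metis add_cancel_left_left add_0)
  show ?thesis
    using assms(2)
  proof (induction A rule: infinite_finite_induct)
    case (insert i A)
    then show ?case
      using assms(1) sum_mem[of A F] by (simp add: complex_linear_on_def)
  qed (simp_all add: zero)
qed

lemma linear_fejer_op:
  assumes f: "complex_linear_on M f" and mem: "T \<in> M" "S \<in> M"
  shows "f (fejer_op T S N z) = (\<Sum>m<N. f id_blinfun +
    (\<Sum>k\<in>{1..m}. z ^ k * f (blinfun_power T k) + cnj z ^ k * f (blinfun_power S k)))"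
proof -
  have add: "P \<in> M \<Longrightarrow> Q \<in> M \<Longrightarrow> f (P + Q) = f P + f Q"
    and scale: "P \<in> M \<Longrightarrow> f (c *\<^sub>C P) = c * f P" for P Q c
    using f by (auto simp: complex_linear_on_def)
  have [simp]: "z ^ k *\<^sub>C blinfun_power T k + cnj z ^ k *\<^sub>C blinfun_power S k \<in> M" for k
    by (intro add_mem scaleC_mem power_mem mem)
  show ?thesis
    unfolding fejer_op_def
    by (simp add: linear_sum_mem[OF f] add scale add_mem sum_mem scaleC_mem power_mem mem id_mem)
qed

text \<open>Only the Fourier coefficients of \<open>z \<mapsto> F z\<close> with index congruent to \<open>0\<close>, respectively \<open>1\<close>,
  modulo the order of the roots survive the summation. The indices lie strictly between \<open>-N\<close> and
  \<open>N\<close>. Order \<open>N + 1\<close> keeps \<open>1 - N\<close> apart from \<open>1\<close>, so there is no aliasing in either sum. The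
  factor \<open>N - 1\<close> counts the blocks \<open>0 < m < N\<close>, the ones in which \<open>T\<close> occurs.\<close>

lemma sum_fejer_op_roots_of_unity:
  fixes N :: nat
  assumes f: "complex_linear_on M f" and mem: "T \<in> M" "S \<in> M"
  defines "\<omega> \<equiv> cis (2 * pi / real (Suc N))"
  shows "(\<Sum>j<Suc N. f (fejer_op T S N (\<omega> ^ j))) = of_nat (Suc N) * (of_nat N * f id_blinfun)"
    and "(\<Sum>j<Suc N. cnj (\<omega> ^ j) * f (fejer_op T S N (\<omega> ^ j)))
      = of_nat (Suc N) * (of_nat (N - 1) * f T)"
proof -
  define a b where "a k = f (blinfun_power T k)" and "b k = f (blinfun_power S k)" for k
  have expand: "(\<Sum>j<Suc N. c j * f (fejer_op T S N (\<omega> ^ j))) = (\<Sum>m<N.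
      (\<Sum>j<Suc N. c j) * f id_blinfun + (\<Sum>k\<in>{1..m}. (\<Sum>j<Suc N. c j * (\<omega> ^ j) ^ k) * a k
        + (\<Sum>j<Suc N. c j * cnj (\<omega> ^ j) ^ k) * b k))" for c
  proof -
    have "(\<Sum>j<Suc N. c j * f (fejer_op T S N (\<omega> ^ j))) = (\<Sum>j<Suc N. \<Sum>m<N.
        c j * f id_blinfun + (\<Sum>k\<in>{1..m}. c j * (\<omega> ^ j) ^ k * a k + c j * cnj (\<omega> ^ j) ^ k * b k))"
      by (simp only: linear_fejer_op[OF f mem] sum_distrib_left distrib_left mult.assoc a_def b_def)
    also have "\<dots> = (\<Sum>m<N. \<Sum>j<Suc N.
        c j * f id_blinfun + (\<Sum>k\<in>{1..m}. c j * (\<omega> ^ j) ^ k * a k + c j * cnj (\<omega> ^ j) ^ k * b k))"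
      by (rule sum.swap)
    also have "\<dots> = (\<Sum>m<N. (\<Sum>j<Suc N. c j * f id_blinfun) + (\<Sum>k\<in>{1..m}. \<Sum>j<Suc N.
        c j * (\<omega> ^ j) ^ k * a k + c j * cnj (\<omega> ^ j) ^ k * b k))"
      by (simp only: sum.distrib sum.swap[of _ "{1.._}" "{..<Suc N}"])
    finally show ?thesis
      by (simp only: sum.distrib sum_distrib_right)
  qed
  \<comment> \<open>Orthogonality relations of the roots of unity, for the coefficients of positive, negative and
    (after multiplication by \<open>cnj z\<close>) shifted index.\<close>
  have pos: "(\<Sum>j<Suc N. (\<omega> ^ j) ^ k) = 0" if "0 < k" "k \<le> N" for k
    using that sum_cis_powers[of k "Suc N"] unfolding \<omega>_def by simp
  have neg: "(\<Sum>j<Suc N. cnj (\<omega> ^ j) ^ k) = 0" if "0 < k" "k \<le> N" for k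
    using arg_cong[OF pos[OF that], of cnj] by (simp only: cnj_sum complex_cnj_power complex_cnj_zero)
  have unit: "cnj (\<omega> ^ j) * \<omega> ^ j = 1" for j
  proof -
    have "cmod (\<omega> ^ j) = 1"
      by (simp add: \<omega>_def norm_power)
    then show ?thesis
      using complex_norm_square[of "\<omega> ^ j"] by (metis mult.commute of_real_1 power_one)
  qed
  have shift: "cnj (\<omega> ^ j) * (\<omega> ^ j) ^ Suc k = (\<omega> ^ j) ^ k" for j k
    by (simp only: power_Suc mult.assoc[symmetric] unit mult_1_left)
  have shifted: "(\<Sum>j<Suc N. cnj (\<omega> ^ j) * (\<omega> ^ j) ^ k) = (if k = 1 then of_nat (Suc N) else 0)"
    if k: "0 < k" "k \<le> N" for k
  proof -
    obtain i where i: "k = Suc i"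
      using k(1) gr0_implies_Suc by blast
    show ?thesis
    proof (cases "i = 0")
      case True
      then show ?thesis by (simp only: i shift) simp
    next
      case False
      then show ?thesis using pos[of i] k(2) by (simp only: i shift) simp
    qed
  qed
  have "(\<Sum>j<Suc N. 1 * f (fejer_op T S N (\<omega> ^ j)))
      = (\<Sum>m<N. of_nat (Suc N) * f id_blinfun + (\<Sum>k\<in>{1..m}. 0))"
    unfolding expand
    by (intro sum.cong arg_cong2[where f = "(+)"] refl) (simp_all only: mult_1_left atLeastAtMost_iff
        pos neg lessThan_iff, auto simp: pos neg simp del: sum.lessThan_Suc complex_cnj_power)
  then show "(\<Sum>j<Suc N. f (fejer_op T S N (\<omega> ^ j))) = of_nat (Suc N) * (of_nat N * f id_blinfun)"
    by (simp add: mult_ac del: sum.lessThan_Suc of_nat_Suc)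
  show "(\<Sum>j<Suc N. cnj (\<omega> ^ j) * f (fejer_op T S N (\<omega> ^ j)))
      = of_nat (Suc N) * (of_nat (N - 1) * f T)"
  proof (cases "N = 0")
    case True
    then show ?thesis using linear_sum_mem[OF f, of "{}"] by (simp add: fejer_op_def)
  next
    case False
    have first: "(\<Sum>j<Suc N. cnj (\<omega> ^ j)) = 0"
      using neg[of 1] False by (simp only: power_one_right)
    have "(\<Sum>j<Suc N. cnj (\<omega> ^ j) * f (fejer_op T S N (\<omega> ^ j)))
        = (\<Sum>m<N. \<Sum>k\<in>{1..m}. if k = 1 then of_nat (Suc N) * a 1 else 0)"
      unfolding expand
    proof (intro sum.cong refl)
      fix m assume m: "m \<in> {..<N}"
      have "(\<Sum>k\<in>{1..m}. (\<Sum>j<Suc N. cnj (\<omega> ^ j) * (\<omega> ^ j) ^ k) * a k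
          + (\<Sum>j<Suc N. cnj (\<omega> ^ j) * cnj (\<omega> ^ j) ^ k) * b k)
        = (\<Sum>k\<in>{1..m}. if k = 1 then of_nat (Suc N) * a 1 else 0)"
      proof (intro sum.cong refl)
        fix k assume "k \<in> {1..m}"
        then have k: "0 < k" "Suc k \<le> N"
          using m by auto
        have "(\<Sum>j<Suc N. cnj (\<omega> ^ j) * cnj (\<omega> ^ j) ^ k) = 0"
          using neg[of "Suc k"] k by (simp only: power_Suc)
        then show "(\<Sum>j<Suc N. cnj (\<omega> ^ j) * (\<omega> ^ j) ^ k) * a k
          + (\<Sum>j<Suc N. cnj (\<omega> ^ j) * cnj (\<omega> ^ j) ^ k) * b k
          = (if k = 1 then of_nat (Suc N) * a 1 else 0)"
          using shifted[of k] k by (simp del: sum.lessThan_Suc of_nat_Suc complex_cnj_power)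
      qed
      then show "(\<Sum>j<Suc N. cnj (\<omega> ^ j)) * f id_blinfun
        + (\<Sum>k\<in>{1..m}. (\<Sum>j<Suc N. cnj (\<omega> ^ j) * (\<omega> ^ j) ^ k) * a k
          + (\<Sum>j<Suc N. cnj (\<omega> ^ j) * cnj (\<omega> ^ j) ^ k) * b k)
        = (\<Sum>k\<in>{1..m}. if k = 1 then of_nat (Suc N) * a 1 else 0)"
        by (simp only: first mult_zero_left add_0)
    qed
    also have "\<dots> = (\<Sum>m<N. if m = 0 then 0 else of_nat (Suc N) * a 1)"
      by (intro sum.cong refl) (simp add: sum.delta del: of_nat_Suc)
    also have "\<dots> = of_nat (Suc N) * (of_nat (N - 1) * a 1)"
    proof -
      obtain n where "N = Suc n"
        using False not0_implies_Suc by blast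
      then show ?thesis
        by (simp add: sum.lessThan_Suc_shift mult_ac del: of_nat_Suc sum.lessThan_Suc)
    qed
    finally show ?thesis
      by (simp only: a_def One_nat_def blinfun_power_one)
  qed
qed

text \<open>This is the passage from positive operators to contractions: the estimate at the positive
  operators \<open>F z\<close> is summed over the roots of unity \<open>z\<close>. The factor \<open>cnj z\<close> that isolates \<open>T\<close>
  has modulus one and disappears from the bound, while on the right the sums of \<open>p (F z)\<close> and
  \<open>q (F z)\<close> see the identity only.\<close>

lemma functional_Cauchy_Schwarz_contraction:
  assumes lin: "complex_linear_on M f" "complex_linear_on M p" "complex_linear_on M q"
    and nonneg: "\<And>P. P \<in> M \<Longrightarrow> positive_op P \<Longrightarrow> 0 \<le> Re (p P)"
      "\<And>P. P \<in> M \<Longrightarrow> positive_op P \<Longrightarrow> 0 \<le> Re (q P)"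
    and CS: "\<And>P. P \<in> M \<Longrightarrow> positive_op P \<Longrightarrow> cmod (f P) \<le> sqrt (Re (p P)) * sqrt (Re (q P))"
    and T: "T \<in> M" "norm T \<le> 1"
  shows "cmod (f T) \<le> sqrt (Re (p id_blinfun)) * sqrt (Re (q id_blinfun))"
proof -
  define R where "R = sqrt (Re (p id_blinfun)) * sqrt (Re (q id_blinfun))"
  obtain S where S: "S \<in> M" "is_adjoint S T"
    using adjoint_ex T(1) by blast
  have bound: "real n * cmod (f T) \<le> real (Suc n) * R" for n
  proof -
    \<comment> \<open>With \<open>N = n + 1\<close> the factor \<open>N - 1\<close> of \<open>T\<close> becomes \<open>n\<close>.\<close>
    define N where "N = Suc n"
    define \<omega> where "\<omega> = cis (2 * pi / real (Suc N))"
    define F where "F j = fejer_op T S N (\<omega> ^ j)" for j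
    have mod1: "cmod (\<omega> ^ j) = 1" for j
      by (simp add: \<omega>_def norm_power)
    have F: "F j \<in> M" "positive_op (F j)" for j
      unfolding F_def using fejer_op_mem positive_fejer_op T S mod1 by auto
    have Re_of_nat_mult: "Re (of_nat k * w) = real k * Re w" for k w
      by simp
    have sums: "(\<Sum>j<Suc N. Re (g (F j))) = real (Suc N) * real N * Re (g id_blinfun)"
      if "complex_linear_on M g" for g
    proof -
      have "(\<Sum>j<Suc N. Re (g (F j))) = Re (of_nat (Suc N) * (of_nat N * g id_blinfun))"
        using sum_fejer_op_roots_of_unity(1)[OF that T(1) S(1), of N]
        unfolding F_def \<omega>_def by (simp only: Re_sum[symmetric])
      also have "\<dots> = real (Suc N) * real N * Re (g id_blinfun)"
        by (simp only: mult.assoc Re_of_nat_mult)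
      finally show ?thesis .
    qed
    have "real (Suc N) * (real n * cmod (f T)) = cmod (\<Sum>j<Suc N. cnj (\<omega> ^ j) * f (F j))"
      unfolding F_def \<omega>_def sum_fejer_op_roots_of_unity(2)[OF lin(1) T(1) S(1), of N]
      by (simp add: norm_mult N_def del: of_nat_Suc)
    also have "\<dots> \<le> (\<Sum>j<Suc N. cmod (cnj (\<omega> ^ j) * f (F j)))"
      by (rule norm_sum)
    also have "\<dots> = (\<Sum>j<Suc N. cmod (f (F j)))"
      by (simp only: norm_mult complex_mod_cnj mod1 mult_1_left)
    also have "\<dots> \<le> (\<Sum>j<Suc N. \<bar>sqrt (Re (p (F j)))\<bar> * \<bar>sqrt (Re (q (F j)))\<bar>)"
      by (rule sum_mono) (use CS[OF F] nonneg F in simp)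
    also have "\<dots> \<le> L2_set (\<lambda>j. sqrt (Re (p (F j)))) {..<Suc N}
        * L2_set (\<lambda>j. sqrt (Re (q (F j)))) {..<Suc N}"
      by (rule L2_set_mult_ineq)
    also have "\<dots> = sqrt (\<Sum>j<Suc N. Re (p (F j))) * sqrt (\<Sum>j<Suc N. Re (q (F j)))"
      by (simp add: L2_set_def nonneg F del: sum.lessThan_Suc)
    also have "\<dots> = real (Suc N) * (real (Suc n) * R)"
    proof -
      have "sqrt (c * a) * sqrt (c * b) = c * (sqrt a * sqrt b)" if "0 \<le> c" for c a b
      proof -
        have "sqrt (c * a) * sqrt (c * b) = (sqrt c * sqrt c) * (sqrt a * sqrt b)"
          by (simp only: real_sqrt_mult mult_ac)
        then show ?thesis
          using that by simp
      qed
      then show ?thesis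
        unfolding sums[OF lin(2)] sums[OF lin(3)] by (simp add: R_def N_def)
    qed
    finally show ?thesis
      by simp
  qed
  have "cmod (f T) - R \<le> 0"
  proof (rule ccontr)
    assume "\<not> cmod (f T) - R \<le> 0"
    then obtain n where "R < real n * (cmod (f T) - R)"
      using reals_Archimedean3[of "cmod (f T) - R"] by auto
    then show False
      using bound[of n] by (simp add: algebra_simps)
  qed
  then show ?thesis
    by (simp add: R_def)
qed

end

lemma star_algebra_von_neumann_algebra: "von_neumann_algebra M \<Longrightarrow> star_algebra M"
  unfolding von_neumann_algebra_def star_algebra_def by blast

section \<open>The Cauchy-Schwarz inequality for operator-valued maps\<close>

theorem proposition4p1:
  fixes M :: "('k::chilbert_space \<Rightarrow>\<^sub>L 'k) set"
    and \<Phi> :: "'x::complex_vector \<Rightarrow> 'x \<Rightarrow> ('k \<Rightarrow>\<^sub>L 'k) \<Rightarrow> ('h::chilbert_space \<Rightarrow>\<^sub>L 'h)"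
  assumes "von_neumann_algebra M"
    and "positive_sesquilinear_map M \<Phi>"
  shows "\<forall>x y. map_norm M (\<Phi> x y) \<le> sqrt (map_norm M (\<Phi> x x)) * sqrt (map_norm M (\<Phi> y y))"
proof (intro allI)
  fix x y
  interpret star_algebra M
    using assms(1) by (rule star_algebra_von_neumann_algebra)
  have sesq: "sesquilinear_map M \<Phi>" and pos: "positive_map M (\<Phi> u u)" for u
    using assms(2) by (auto simp: positive_sesquilinear_map_def)
  have maps: "\<Phi> u v \<in> bounded_maps M" for u v
    using sesq by (simp add: sesquilinear_map_def)
  define \<phi> where "\<phi> h u v T = cinner (blinfun_apply (\<Phi> u v T) h) h" for h u v T
  have lin: "complex_linear_on M (\<phi> h u v)" for h u v
    using maps[of u v]
    by (simp add: complex_linear_on_def bounded_maps_def \<phi>_def blinfun.add_left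
        scaleC_blinfun.rep_eq cinner_add_left cinner_scaleC_left)
  have nonneg: "\<phi> h u u P \<in> \<real>\<^sub>\<ge>\<^sub>0" if "P \<in> M" "positive_op P" for h u P
    using pos[of u] that by (auto simp: positive_map_def positive_op_def \<phi>_def)
  have CS: "cmod (\<phi> h u v P) \<le> sqrt (Re (\<phi> h u u P)) * sqrt (Re (\<phi> h v v P))"
    if "P \<in> M" "positive_op P" for h u v P
  proof (rule Cauchy_Schwarz_positive_form[of "\<lambda>u v. \<phi> h u v P"])
    show "\<phi> h u u P \<in> \<real>\<^sub>\<ge>\<^sub>0" for u
      using nonneg that .
  qed (use sesq that(1) in \<open>simp_all add: sesquilinear_map_def \<phi>_def blinfun.add_left
        scaleC_blinfun.rep_eq cinner_add_left cinner_scaleC_left\<close>)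
  have id_norm: "norm (id_blinfun :: 'k \<Rightarrow>\<^sub>L 'k) \<le> 1"
    by (rule norm_blinfun_id_le)
  have diag: "Re (\<phi> h u u id_blinfun) \<le> map_norm M (\<Phi> u u)" if "norm h = 1" for h u
  proof -
    have "Re (\<phi> h u u id_blinfun) \<le> cmod (\<phi> h u u id_blinfun)"
      by (rule complex_Re_le_cmod)
    also have "\<dots> \<le> numerical_radius (\<Phi> u u id_blinfun)"
      unfolding \<phi>_def using that by (rule cinner_le_numerical_radius)
    also have "\<dots> \<le> map_norm M (\<Phi> u u)"
      using maps id_mem id_norm by (rule numerical_radius_le_map_norm)
    finally show ?thesis .
  qed
  have map_norm_nonneg: "0 \<le> map_norm M (\<Phi> u u)" for u
    using numerical_radius_nonneg numerical_radius_le_map_norm[OF maps id_mem id_norm]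
    by (rule order_trans)
  have "positive_op (id_blinfun :: 'k \<Rightarrow>\<^sub>L 'k)"
    using bounded id_mem by (auto simp: positive_op_def cinner_self simp del: of_real_power)
  then have re_nonneg: "0 \<le> Re (\<phi> h u u id_blinfun)" for h u
    using nonneg[OF id_mem] by (simp add: complex_nonneg_Reals_iff)
  let ?r = "sqrt (map_norm M (\<Phi> x x)) * sqrt (map_norm M (\<Phi> y y))"
  have "numerical_radius (\<Phi> x y T) \<le> ?r" if T: "T \<in> M" "norm T \<le> 1" for T
  proof (rule numerical_radius_leI)
    fix h :: 'h assume h: "norm h = 1"
    have "cmod (\<phi> h x y T) \<le> sqrt (Re (\<phi> h x x id_blinfun)) * sqrt (Re (\<phi> h y y id_blinfun))"
      using lin lin lin _ _ CS T
      by (rule functional_Cauchy_Schwarz_contraction)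
        (use nonneg in \<open>auto simp: complex_nonneg_Reals_iff\<close>)
    also have "\<dots> \<le> ?r"
      using diag[OF h, of x] diag[OF h, of y]
      by (intro mult_mono) (simp_all add: map_norm_nonneg re_nonneg)
    finally show "cmod (cinner (blinfun_apply (\<Phi> x y T) h) h) \<le> ?r"
      by (simp add: \<phi>_def)
  qed (simp add: map_norm_nonneg)
  then show "map_norm M (\<Phi> x y) \<le> ?r"
    unfolding map_norm_def[of M "\<Phi> x y"] using id_mem id_norm by (intro cSUP_least) auto
qed

end
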